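(* Let $u\in\mathbb{R}_d[\boldsymbol{x}]$ be the $u$-component of an (optimal) solution of the following sum-of-squares program, in the unknowns $u\in\mathbb{R}_d[\boldsymbol{x}]$, $s^{X_i}_{i,l_1},\,s^{D}_{i,l_2},\,s_{i,1}\in\mathtt{SOS}(\boldsymbol{x},\boldsymbol{d})$ and $s'_{1,j}\in\mathtt{SOS}(\boldsymbol{x})$ (for $i=1,\ldots,k$, $l_1=1,\ldots,n_i$, $l_2=1,\ldots,n_{k+1}$, $j=1,\ldots,n_0$), the multiplier polynomials having prescribed degree bounds: $$\begin{aligned} \text{minimize}\quad & \int_{B}u(\boldsymbol{x})\,d\mu(\boldsymbol{x})\\ \text{subject to}\quad & u(\boldsymbol{x})-u(\boldsymbol{f}_i(\boldsymbol{x},\boldsymbol{d}))+\sum_{l_1=1}^{n_i}s^{X_i}_{i,l_1}h_{i,l_1}(\boldsymbol{x})+\sum_{l_2=1}^{n_{k+1}}s^{D}_{i,l_2}h_{k+1,l_2}(\boldsymbol{d})-s_{i,1}h(\boldsymbol{x})\in\mathtt{SOS}(\boldsymbol{x},\boldsymbol{d}),\quad i=1,\ldots,k,\\ & u(\boldsymbol{x})-h_{0,j}(\boldsymbol{x})-s'_{1,j}h(\boldsymbol{x})\in\mathtt{SOS}(\boldsymbol{x}),\quad j=1,\ldots,n_0, \end{aligned}$$ where $\mu$ is Lebesgue measure. Then $\{\boldsymbol{x}\in B\mid u(\boldsymbol{x})\le 0\}\subseteq\mathcal{R}_0$, i.e. every possible run of the program starting from a state in $\{\boldsymbol{x}\in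 B\mid u(\boldsymbol{x})\le 0\}$ does not terminate.
   Context: $\mathbb{N}$ denotes the nonnegative integers. $\mathbb{R}_d[\boldsymbol{x}]$ is the vector space of real polynomials in $\boldsymbol{x}=(x_1,\ldots,x_n)$ of degree (at most) $d$. $\mathtt{SOS}(\boldsymbol{y})$ is the set of polynomials $p\in\mathbb{R}[\boldsymbol{y}]$ of the form $p=\sum_{i=1}^r q_i^2$ with $q_i\in\mathbb{R}[\boldsymbol{y}]$. The program under consideration is a single loop: starting from $\boldsymbol{x}:=\boldsymbol{x}_0$, while $\boldsymbol{x}\in X_0$ it executes $\boldsymbol{x}:=\boldsymbol{f}_i(\boldsymbol{x},\boldsymbol{d})$ for the unique $i\in\{1,\ldots,k\}$ with $\boldsymbol{x}\in X_i$, where $\boldsymbol{d}\in D$ is chosen nondeterministically at each iteration. Data: $D=\{\boldsymbol{d}\in\mathbb{R}^m\mid \bigwedge_{i=1}^{n_{k+1}} h_{k+1,i}(\boldsymbol{d})\le 0\}$ is compact; $X_0=\{\boldsymbol{x}\in\mathbb{R}^n\mid \bigwedge_{i=1}^{n_0} h_{0,i}(\boldsymbol{x})\le 0\}$ is compact; for $j=1,\ldots,k$, $X_j=\{\boldsymbol{x}\in\mathbb{R}^n\mid \bigwedge_{i=1}^{n_j} h_{j,i}(\boldsymbol{x})\rhd 0\}$, where each $\rhd$ is $\le$ or $<$. The sets $X_1,\ldots,X_k$ are pairwise disjoint with union $\mathbb{R}^n$. It is assumed that each $\boldsymbol{f}_i$ ($i=1,\ldots,k$) is a polynomial map in $(\boldsymbol{x},\boldsymbol{d})$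 with values in $\mathbb{R}^n$, and that $D,X_0,\ldots,X_k$ are basic semi-algebraic, i.e. all $h_{j,i}$ ($j=0,\ldots,k+1$) are polynomials. Define $\boldsymbol{f}:\mathbb{R}^n\times D\to\mathbb{R}^n$ by $\boldsymbol{f}(\boldsymbol{x},\boldsymbol{d})=\boldsymbol{f}_i(\boldsymbol{x},\boldsymbol{d})$ when $\boldsymbol{x}\in X_i$. The ball: $B=\{\boldsymbol{x}\in\mathbb{R}^n\mid h(\boldsymbol{x})\ge 0\}$ with $h(\boldsymbol{x})=R-\sum_{i=1}^n x_i^2$, where $R$ is a constant such that $\Omega(X_0)\subseteq B$, with $$\Omega(X_0)=\{\boldsymbol{f}(\boldsymbol{x}_0,\boldsymbol{d})\mid \boldsymbol{x}_0\in X_0,\ \boldsymbol{d}\in D\}\cup X_0 .$$ Input policies: $\Pi$ is the set of all maps $\boldsymbol{\pi}:\mathbb{N}\to D$. For $\boldsymbol{x}_0\in\mathbb{R}^n$ and $\pi\in\Pi$, the trajectory $\boldsymbol{x}^{\pi}_{\boldsymbol{x}_0}:\mathbb{N}\to\mathbb{R}^n$ is defined by $\boldsymbol{x}^{\pi}_{\boldsymbol{x}_0}(0)=\boldsymbol{x}_0$ and $\boldsymbol{x}^{\pi}_{\boldsymbol{x}_0}(l+1)=\boldsymbol{f}(\boldsymbol{x}^{\pi}_{\boldsymbol{x}_0}(l),\boldsymbol{\pi}(l))$. The maximal robust nontermination set $\mathcal{R}_0$ is the set of all $\boldsymbol{x}_0\in\mathbb{R}^n$ such that $\boldsymbol{x}^{\pi}_{\boldsymbol{x}_0}(l)\in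 X_0$ for all $\pi\in\Pi$ and all $l\in\mathbb{N}$. *)

theory Defs
  imports "HOL-Analysis.Analysis" "HOL-Library.Poly_Mapping"
begin

text \<open>
  Polynomials are formal: finitely supported maps from exponent vectors to coefficients, with the
  convolution product. The variables are indexed by \<open>'v\<close>. Thus \<open>'n mpoly\<close> is the ring of
  polynomials in \<open>x\<close> and \<open>('n + 'm) mpoly\<close> the ring of polynomials in \<open>(x, d)\<close>, where
  \<open>Inl v\<close> indexes the components of \<open>x\<close> and \<open>Inr w\<close> those of \<open>d\<close>.
\<close>

type_synonym 'v mpoly = "('v \<Rightarrow>\<^sub>0 nat) \<Rightarrow>\<^sub>0 real"

definition mpoly_const :: "real \<Rightarrow> 'v mpoly" where
  "mpoly_const c = Poly_Mapping.single 0 c"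

definition mpoly_var :: "'v \<Rightarrow> 'v mpoly" where
  "mpoly_var v = Poly_Mapping.single (Poly_Mapping.single v 1) 1"

text \<open>Evaluation in a commutative real algebra whose scalars are embedded by \<open>c\<close>.\<close>

definition mpoly_aeval :: "(real \<Rightarrow> 'b) \<Rightarrow> ('v \<Rightarrow> 'b) \<Rightarrow> 'v mpoly \<Rightarrow> 'b::comm_semiring_1" where
  "mpoly_aeval c g p =
    (\<Sum>e\<in>Poly_Mapping.keys p. c (Poly_Mapping.lookup p e) *
      (\<Prod>v\<in>Poly_Mapping.keys e. g v ^ Poly_Mapping.lookup e v))"

definition mpoly_eval :: "'v mpoly \<Rightarrow> ('v \<Rightarrow> real) \<Rightarrow> real" where
  "mpoly_eval p a = mpoly_aeval (\<lambda>c. c) a p"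

definition mpoly_subst :: "('v \<Rightarrow> 'w mpoly) \<Rightarrow> 'v mpoly \<Rightarrow> 'w mpoly" where
  "mpoly_subst g p = mpoly_aeval mpoly_const g p"

definition in_x :: "'n mpoly \<Rightarrow> ('n + 'm) mpoly" where
  "in_x p = mpoly_subst (\<lambda>v. mpoly_var (Inl v)) p"

definition in_d :: "'m mpoly \<Rightarrow> ('n + 'm) mpoly" where
  "in_d p = mpoly_subst (\<lambda>w. mpoly_var (Inr w)) p"

definition mpoly_deg_le :: "nat \<Rightarrow> 'v mpoly set" where
  "mpoly_deg_le k =
    {p. \<forall>e\<in>Poly_Mapping.keys p. (\<Sum>v\<in>Poly_Mapping.keys e. Poly_Mapping.lookup e v) \<le> k}"

definition SOS :: "'v mpoly set" where
  "SOS = {p. \<exists>(r::nat) q. p = (\<Sum>i=1..r. (q i)\<^sup>2)}"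

definition semialg :: "nat \<Rightarrow> (nat \<Rightarrow> 'v mpoly) \<Rightarrow> (nat \<Rightarrow> bool) \<Rightarrow> (real ^ 'v) set" where
  "semialg N h strict =
    {x. \<forall>i\<in>{1..N}. if strict i then mpoly_eval (h i) (($) x) < 0 else mpoly_eval (h i) (($) x) \<le> 0}"

text \<open>
  \<open>branches\<close> is $k$, and \<open>update i\<close> is the tuple of components of the polynomial map $f_i$.
  \<open>num_con j\<close> and \<open>con j i\<close> are $n_j$ and $h_{j,i}$ for $j = 0, \ldots, k$;
  \<open>strict_con j i\<close> tells whether the $i$-th inequality of $X_j$ is strict (used for
  $j = 1, \ldots, k$ only). The constraints $h_{k+1,i}$ describing $D$ are polynomials in other
  variables, and they are kept separately in \<open>num_dcon\<close> and \<open>dcon\<close>.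
\<close>

record ('n, 'm) loop_data =
  branches :: nat
  update :: "nat \<Rightarrow> 'n \<Rightarrow> ('n + 'm) mpoly"
  num_con :: "nat \<Rightarrow> nat"
  con :: "nat \<Rightarrow> nat \<Rightarrow> 'n mpoly"
  strict_con :: "nat \<Rightarrow> nat \<Rightarrow> bool"
  num_dcon :: nat
  dcon :: "nat \<Rightarrow> 'm mpoly"

definition input_set :: "('n::finite, 'm::finite) loop_data \<Rightarrow> (real ^ 'm) set" where
  "input_set P = semialg (num_dcon P) (dcon P) (\<lambda>_. False)"

definition guard_set :: "('n::finite, 'm::finite) loop_data \<Rightarrow> (real ^ 'n) set" where
  "guard_set P = semialg (num_con P 0) (con P 0) (\<lambda>_. False)"

definition branch_set :: "('n::finite, 'm::finite) loop_data \<Rightarrow> nat \<Rightarrow> (real ^ 'n) set" where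
  "branch_set P j = semialg (num_con P j) (con P j) (strict_con P j)"

definition branch_map :: "('n::finite, 'm::finite) loop_data \<Rightarrow> nat \<Rightarrow> real ^ 'n \<Rightarrow> real ^ 'm \<Rightarrow> real ^ 'n" where
  "branch_map P i x d = (\<chi> v. mpoly_eval (update P i v) (case_sum (($) x) (($) d)))"

definition step :: "('n::finite, 'm::finite) loop_data \<Rightarrow> real ^ 'n \<Rightarrow> real ^ 'm \<Rightarrow> real ^ 'n" where
  "step P x d = branch_map P (THE i. i \<in> {1..branches P} \<and> x \<in> branch_set P i) x d"

definition policies :: "('n::finite, 'm::finite) loop_data \<Rightarrow> (nat \<Rightarrow> real ^ 'm) set" where
  "policies P = {\<pi>. \<forall>l. \<pi> l \<in> input_set P}"

primrec trajectory ::
  "('n::finite, 'm::finite) loop_data \<Rightarrow> (nat \<Rightarrow> real ^ 'm) \<Rightarrow> real ^ 'n \<Rightarrow> nat \<Rightarrow> real ^ 'n" where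
  "trajectory P \<pi> x0 0 = x0"
| "trajectory P \<pi> x0 (Suc l) = step P (trajectory P \<pi> x0 l) (\<pi> l)"

definition robust_nontermination_set :: "('n::finite, 'm::finite) loop_data \<Rightarrow> (real ^ 'n) set" where
  "robust_nontermination_set P =
    {x0. \<forall>\<pi>\<in>policies P. \<forall>l. trajectory P \<pi> x0 l \<in> guard_set P}"

definition one_step_reach :: "('n::finite, 'm::finite) loop_data \<Rightarrow> (real ^ 'n) set" where
  "one_step_reach P =
    {step P x0 d | x0 d. x0 \<in> guard_set P \<and> d \<in> input_set P} \<union> guard_set P"

definition ball_poly :: "real \<Rightarrow> 'n::finite mpoly" where
  "ball_poly R = mpoly_const R - (\<Sum>v\<in>UNIV. (mpoly_var v)\<^sup>2)"

definition ball_set :: "real \<Rightarrow> (real ^ 'n::finite) set" where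
  "ball_set R = {x. mpoly_eval (ball_poly R) (($) x) \<ge> 0}"

text \<open>
  The unknowns $u$, $s^{X_i}_{i,l}$, $s^D_{i,l}$, $s_{i,1}$ and $s'_{1,j}$. Entries outside the
  index ranges of the program are irrelevant.
\<close>

record ('n, 'm) sos_vars =
  u_part :: "'n mpoly"
  s_X :: "nat \<Rightarrow> nat \<Rightarrow> ('n + 'm) mpoly"
  s_D :: "nat \<Rightarrow> nat \<Rightarrow> ('n + 'm) mpoly"
  s_B :: "nat \<Rightarrow> ('n + 'm) mpoly"
  s_guard :: "nat \<Rightarrow> 'n mpoly"

record sos_degrees =
  deg_u :: nat
  deg_X :: "nat \<Rightarrow> nat \<Rightarrow> nat"
  deg_D :: "nat \<Rightarrow> nat \<Rightarrow> nat"
  deg_B :: "nat \<Rightarrow> nat"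
  deg_guard :: "nat \<Rightarrow> nat"

definition sos_feasible ::
  "('n::finite, 'm::finite) loop_data \<Rightarrow> real \<Rightarrow> sos_degrees \<Rightarrow> ('n, 'm) sos_vars \<Rightarrow> bool" where
  "sos_feasible P R b z \<longleftrightarrow>
    u_part z \<in> mpoly_deg_le (deg_u b) \<and>
    (\<forall>i\<in>{1..branches P}.
      (\<forall>l\<in>{1..num_con P i}. s_X z i l \<in> SOS \<inter> mpoly_deg_le (deg_X b i l)) \<and>
      (\<forall>l\<in>{1..num_dcon P}. s_D z i l \<in> SOS \<inter> mpoly_deg_le (deg_D b i l)) \<and>
      s_B z i \<in> SOS \<inter> mpoly_deg_le (deg_B b i)) \<and>
    (\<forall>j\<in>{1..num_con P 0}. s_guard z j \<in> SOS \<inter> mpoly_deg_le (deg_guard b j)) \<and>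
    (\<forall>i\<in>{1..branches P}.
      in_x (u_part z) - mpoly_subst (update P i) (u_part z)
        + (\<Sum>l=1..num_con P i. s_X z i l * in_x (con P i l))
        + (\<Sum>l=1..num_dcon P. s_D z i l * in_d (dcon P l))
        - s_B z i * in_x (ball_poly R) \<in> SOS) \<and>
    (\<forall>j\<in>{1..num_con P 0}.
      u_part z - con P 0 j - s_guard z j * ball_poly R \<in> SOS)"

definition sos_objective :: "real \<Rightarrow> ('n::finite, 'm) sos_vars \<Rightarrow> real" where
  "sos_objective R z = (LINT x:ball_set R|lborel. mpoly_eval (u_part z) (($) x))"

definition sos_optimal ::
  "('n::finite, 'm::finite) loop_data \<Rightarrow> real \<Rightarrow> sos_degrees \<Rightarrow> ('n, 'm) sos_vars \<Rightarrow> bool" where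
  "sos_optimal P R b z \<longleftrightarrow> is_arg_min (sos_objective R) (sos_feasible P R b) z"

end

theory Submission
  imports Defs
begin

text \<open>
  Evaluating the certificates at a point turns them into inequalities. On the ball, the guard
  certificate gives \<open>con P 0 j \<le> u\<close>, so the sublevel set \<open>{x \<in> B. u x \<le> 0}\<close> lies in the loop guard.
  From the guard, a step stays in the ball by the choice of \<open>R\<close>, and on the branch that is taken the
  branch certificate gives \<open>u (f x d) \<le> u x\<close>. Hence the sublevel set is invariant.
\<close>

definition mpoly_monom_eval :: "('v \<Rightarrow> real) \<Rightarrow> ('v \<Rightarrow>\<^sub>0 nat) \<Rightarrow> real" where
  "mpoly_monom_eval a e = (\<Prod>v\<in>Poly_Mapping.keys e. a v ^ Poly_Mapping.lookup e v)"

text \<open>The added factors are zeroth powers. A common index set lets \<open>e\<close>,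
  \<open>f\<close> and \<open>e + f\<close> be compared factor by factor.\<close>

lemma mpoly_monom_eval_superset:
  assumes "finite V" "Poly_Mapping.keys e \<subseteq> V"
  shows "mpoly_monom_eval a e = (\<Prod>v\<in>V. a v ^ Poly_Mapping.lookup e v)"
  unfolding mpoly_monom_eval_def
  by (rule prod.mono_neutral_left) (use assms in \<open>auto simp: in_keys_iff\<close>)

lemma mpoly_monom_eval_0 [simp]: "mpoly_monom_eval a 0 = 1"
  by (simp add: mpoly_monom_eval_def)

lemma mpoly_monom_eval_add:
  "mpoly_monom_eval a (e + f) = mpoly_monom_eval a e * mpoly_monom_eval a f"
proof -
  let ?V = "Poly_Mapping.keys e \<union> Poly_Mapping.keys f"
  have "finite ?V" "Poly_Mapping.keys (e + f) \<subseteq> ?V"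
    by (simp_all add: Poly_Mapping.keys_add)
  then show ?thesis
    by (simp add: mpoly_monom_eval_superset [where V = ?V] lookup_add power_add prod.distrib)
qed

text \<open>The added coefficients are zero. The freedom in \<open>K\<close> matters for sums, where
  cancellation can make the support of \<open>p + q\<close> smaller than the union of the two
  supports.\<close>

lemma mpoly_eval_superset:
  assumes "finite K" "Poly_Mapping.keys p \<subseteq> K"
  shows "mpoly_eval p a = (\<Sum>e\<in>K. Poly_Mapping.lookup p e * mpoly_monom_eval a e)"
  unfolding mpoly_eval_def mpoly_aeval_def mpoly_monom_eval_def
  by (rule sum.mono_neutral_left) (use assms in \<open>auto simp: in_keys_iff\<close>)

lemma mpoly_eval_single [simp]:
  "mpoly_eval (Poly_Mapping.single e c) a = c * mpoly_monom_eval a e"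
  by (subst mpoly_eval_superset [where K = "{e}"]) (auto simp: lookup_single)

lemma mpoly_eval_0 [simp]: "mpoly_eval 0 a = 0"
  by (simp add: mpoly_eval_def mpoly_aeval_def)

lemma mpoly_eval_1 [simp]: "mpoly_eval 1 a = 1"
  by (simp flip: single_one)

lemma mpoly_eval_const [simp]: "mpoly_eval (mpoly_const c) a = c"
  by (simp add: mpoly_const_def)

lemma mpoly_eval_var [simp]: "mpoly_eval (mpoly_var v) a = a v"
  by (simp add: mpoly_var_def mpoly_monom_eval_def)

lemma mpoly_eval_add [simp]: "mpoly_eval (p + q) a = mpoly_eval p a + mpoly_eval q a"
proof -
  let ?K = "Poly_Mapping.keys p \<union> Poly_Mapping.keys q"
  have "finite ?K" "Poly_Mapping.keys (p + q) \<subseteq> ?K"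
    by (simp_all add: Poly_Mapping.keys_add)
  then show ?thesis
    by (simp add: mpoly_eval_superset [where K = ?K] lookup_add distrib_right sum.distrib)
qed

lemma mpoly_eval_diff [simp]: "mpoly_eval (p - q) a = mpoly_eval p a - mpoly_eval q a"
  using mpoly_eval_add [of "p - q" q a] by simp

lemma mpoly_eval_sum [simp]: "mpoly_eval (sum f A) a = (\<Sum>i\<in>A. mpoly_eval (f i) a)"
  by (induction A rule: infinite_finite_induct) auto

text \<open>This expansion reduces multiplicativity of evaluation to products of single terms, where
  exponents add.\<close>

lemma mpoly_eq_sum_single:
  "p = (\<Sum>e\<in>Poly_Mapping.keys p. Poly_Mapping.single e (Poly_Mapping.lookup p e))"
  by (rule poly_mapping_eqI)
    (simp add: lookup_sum lookup_single when_def in_keys_iff)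

lemma mpoly_eval_mult [simp]: "mpoly_eval (p * q) a = mpoly_eval p a * mpoly_eval q a"
proof -
  let ?s = "\<lambda>p e. Poly_Mapping.single e (Poly_Mapping.lookup p e)"
  have "p * q = (\<Sum>e\<in>Poly_Mapping.keys p. ?s p e) * (\<Sum>f\<in>Poly_Mapping.keys q. ?s q f)"
    using mpoly_eq_sum_single [of p] mpoly_eq_sum_single [of q] by simp
  also have "mpoly_eval \<dots> a =
      mpoly_eval (\<Sum>e\<in>Poly_Mapping.keys p. ?s p e) a * mpoly_eval (\<Sum>f\<in>Poly_Mapping.keys q. ?s q f) a"
    by (simp add: sum_product mult_single mpoly_monom_eval_add mult_ac)
  finally show ?thesis
    using mpoly_eq_sum_single [of p] mpoly_eq_sum_single [of q] by simp
qed

lemma mpoly_eval_power [simp]: "mpoly_eval (p ^ k) a = mpoly_eval p a ^ k"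
  by (induction k) auto

lemma mpoly_eval_prod [simp]: "mpoly_eval (prod f A) a = (\<Prod>i\<in>A. mpoly_eval (f i) a)"
  by (induction A rule: infinite_finite_induct) auto

text \<open>Substitution is itself evaluation in a polynomial ring with scalars
  \<open>mpoly_const\<close>. Evaluation at \<open>a\<close> is a ring homomorphism that sends each
  constant polynomial to its value, so it passes through the sums, products and powers.\<close>

lemma mpoly_eval_subst [simp]:
  "mpoly_eval (mpoly_subst g p) a = mpoly_eval p (\<lambda>v. mpoly_eval (g v) a)"
  by (simp add: mpoly_subst_def mpoly_aeval_def mpoly_eval_def [of p])

lemma mpoly_eval_in_x [simp]: "mpoly_eval (in_x p) (case_sum a c) = mpoly_eval p a"
  by (simp add: in_x_def)

lemma mpoly_eval_in_d [simp]: "mpoly_eval (in_d p) (case_sum a c) = mpoly_eval p c"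
  by (simp add: in_d_def)

lemma mpoly_eval_SOS_nonneg: "p \<in> SOS \<Longrightarrow> 0 \<le> mpoly_eval p a"
  by (auto simp: SOS_def sum_nonneg)

text \<open>Moves the value at the successor state to the joint point (x, d), where the branch
  certificate is evaluated.\<close>

lemma mpoly_eval_branch_map:
  "mpoly_eval p (($) (branch_map P i x d)) =
    mpoly_eval (mpoly_subst (update P i) p) (case_sum (($) x) (($) d))"
  by (simp add: branch_map_def vec_lambda_inverse)

text \<open>Strict constraints are weakened, since a weak sign suffices for the product with a
  nonnegative multiplier.\<close>

lemma semialg_nonpos:
  assumes "x \<in> semialg N h strict" "i \<in> {1..N}"
  shows "mpoly_eval (h i) (($) x) \<le> 0"
  using assms unfolding semialg_def by (force split: if_splits)

lemma step_eq_branch_map: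
  assumes "disjoint_family_on (branch_set P) {1..branches P}"
    and "i \<in> {1..branches P}" "x \<in> branch_set P i"
  shows "step P x d = branch_map P i x d"
proof -
  have "(THE i. i \<in> {1..branches P} \<and> x \<in> branch_set P i) = i"
    using assms by (intro the_equality) (unfold disjoint_family_on_def, blast+)
  then show ?thesis
    by (simp add: step_def)
qed

lemma sos_feasible_guard:
  assumes "sos_feasible P R b z" "x \<in> ball_set R" "mpoly_eval (u_part z) (($) x) \<le> 0"
  shows "x \<in> guard_set P"
proof -
  have "mpoly_eval (con P 0 j) (($) x) \<le> 0" if j: "j \<in> {1..num_con P 0}" for j
  proof -
    have "s_guard z j \<in> SOS" "u_part z - con P 0 j - s_guard z j * ball_poly R \<in> SOS"
      using assms(1) j by (auto simp: sos_feasible_def)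
    \<comment> \<open>On the ball the subtracted product is nonnegative, so dropping it keeps the
      certificate inequality and leaves \<open>con P 0 j\<close> at most \<open>u_part z\<close> at
      \<open>x\<close>.\<close>
    from this [THEN mpoly_eval_SOS_nonneg, of "($) x"] have
      "0 \<le> mpoly_eval (s_guard z j) (($) x) * mpoly_eval (ball_poly R) (($) x)"
      "0 \<le> mpoly_eval (u_part z) (($) x) - mpoly_eval (con P 0 j) (($) x)
        - mpoly_eval (s_guard z j) (($) x) * mpoly_eval (ball_poly R) (($) x)"
      using assms(2) by (auto simp: ball_set_def)
    then show ?thesis
      using assms(3) by linarith
  qed
  then show ?thesis
    by (simp add: guard_set_def semialg_def)
qed

text \<open>At (x, d) the sums with \<open>s_X\<close> and \<open>s_D\<close> are nonpositive, and
  so is the ball term with its minus sign. As the whole expression is nonnegative, the remaining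
  difference of the two values of \<open>u_part z\<close> must be nonnegative.\<close>

lemma sos_feasible_branch_decreasing:
  assumes "sos_feasible P R b z" "x \<in> ball_set R" "d \<in> input_set P"
    and i: "i \<in> {1..branches P}" "x \<in> branch_set P i"
  shows "mpoly_eval (u_part z) (($) (branch_map P i x d)) \<le> mpoly_eval (u_part z) (($) x)"
proof -
  let ?a = "case_sum (($) x) (($) d)"
  have SOS_X: "s_X z i l \<in> SOS" if "l \<in> {1..num_con P i}" for l
    using assms(1) i that by (simp add: sos_feasible_def)
  have SOS_D: "s_D z i l \<in> SOS" if "l \<in> {1..num_dcon P}" for l
    using assms(1) i that by (simp add: sos_feasible_def)
  have SOS_B: "s_B z i \<in> SOS"
    using assms(1) i by (simp add: sos_feasible_def)
  have X: "(\<Sum>l=1..num_con P i. mpoly_eval (s_X z i l) ?a * mpoly_eval (con P i l) (($) x)) \<le> 0"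
    using i(2) unfolding branch_set_def
    by (intro sum_nonpos mult_nonneg_nonpos mpoly_eval_SOS_nonneg SOS_X semialg_nonpos)
  have D: "(\<Sum>l=1..num_dcon P. mpoly_eval (s_D z i l) ?a * mpoly_eval (dcon P l) (($) d)) \<le> 0"
    using assms(3) unfolding input_set_def
    by (intro sum_nonpos mult_nonneg_nonpos mpoly_eval_SOS_nonneg SOS_D semialg_nonpos)
  have B: "0 \<le> mpoly_eval (s_B z i) ?a * mpoly_eval (ball_poly R) (($) x)"
    using assms(2) mpoly_eval_SOS_nonneg [OF SOS_B] by (simp add: ball_set_def)
  have "in_x (u_part z) - mpoly_subst (update P i) (u_part z)
        + (\<Sum>l=1..num_con P i. s_X z i l * in_x (con P i l))
        + (\<Sum>l=1..num_dcon P. s_D z i l * in_d (dcon P l))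
        - s_B z i * in_x (ball_poly R) \<in> SOS"
    using assms(1) i unfolding sos_feasible_def by blast
  from mpoly_eval_SOS_nonneg [OF this, of ?a] X D B show ?thesis
    unfolding mpoly_eval_branch_map mpoly_eval_add mpoly_eval_diff mpoly_eval_sum mpoly_eval_mult
      mpoly_eval_in_x mpoly_eval_in_d by linarith
qed

theorem theorem3:
  fixes P :: "('n::finite, 'm::finite) loop_data"
    and R :: real
    and b :: sos_degrees
    and z :: "('n, 'm) sos_vars"
  assumes "compact (input_set P)"
    and "compact (guard_set P)"
    and "disjoint_family_on (branch_set P) {1..branches P}"
    and "(\<Union>i\<in>{1..branches P}. branch_set P i) = UNIV"
    and "one_step_reach P \<subseteq> ball_set R"
    and "sos_feasible P R b z \<or> sos_optimal P R b z"
  shows "{x \<in> ball_set R. mpoly_eval (u_part z) (($) x) \<le> 0} \<subseteq> robust_nontermination_set P"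
    (is "?S \<subseteq> _")
proof
  \<comment> \<open>A minimizer is in particular feasible.\<close>
  have feasible: "sos_feasible P R b z"
    using assms(6) by (auto simp: sos_optimal_def is_arg_min_def)
  have step_closed: "step P x d \<in> ?S" if x: "x \<in> ?S" and d: "d \<in> input_set P" for x d
  proof -
    obtain i where i: "i \<in> {1..branches P}" "x \<in> branch_set P i"
      using assms(4) by blast
    have "x \<in> guard_set P"
      using sos_feasible_guard [OF feasible] x by simp
    \<comment> \<open>The successor of a guard state under an admissible input belongs to
      \<open>one_step_reach P\<close>.\<close>
    then have "step P x d \<in> ball_set R"
      using d assms(5) by (auto simp: one_step_reach_def)
    moreover have "mpoly_eval (u_part z) (($) (step P x d)) \<le> mpoly_eval (u_part z) (($) x)"
      using sos_feasible_branch_decreasing [OF feasible _ d i] x step_eq_branch_map [OF assms(3) i]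
      by simp
    ultimately show ?thesis
      using x by simp
  qed
  fix x assume x: "x \<in> ?S"
  have "trajectory P \<pi> x l \<in> ?S" if "\<pi> \<in> policies P" for \<pi> l
  proof (induction l)
    case 0
    then show ?case
      using x by simp
  next
    case (Suc l)
    then show ?case
      using step_closed [of _ "\<pi> l"] that by (simp add: policies_def)
  qed
  then show "x \<in> robust_nontermination_set P"
    using sos_feasible_guard [OF feasible] by (simp add: robust_nontermination_set_def)
qed

end
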